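(* Let $M$ be a loopless matroid on a ground set with $n$ elements. Then $$[s^2]Z^{\mathrm{top}}_M(s)=\binom{n+1}{2}+c(M),$$ where $[s^2]$ denotes the coefficient of $s^2$ in the power series expansion at $s=0$, and $c(M)$ is the number of circuits of size $2$ of $M$, i.e. the number of unordered pairs of distinct elements that are parallel to each other. In particular, if $M$ is simple, then $[s^2]Z^{\mathrm{top}}_M(s)=\binom{n+1}{2}$.
   Context: For a loopless matroid $M$ on a finite ground set $E$, $\mathcal{L}(M)$ is its lattice of flats (with bottom $\varnothing$ and top $E$), $\mu_{F,G}$ is the Möbius function of $\mathcal{L}(M)$, and for a flat $F$, $M|_F$ and $M/F$ denote restriction to and contraction by $F$ (both are loopless). The characteristic polynomial is $\chi_M(x)=\sum_{F\in\mathcal{L}(M)}\mu_{\varnothing,F}\,x^{\mathrm{rk}(M)-\mathrm{rk}_M(F)}$, and for $\mathrm{rk}(M)>0$ the reduced characteristic polynomial is $\overline{\chi}_M(x)=\chi_M(x)/(x-1)$. The topological zeta function $Z^{\mathrm{top}}_M(s)\in\mathbb{Q}(s)$ is defined for all loopless matroids recursively as follows. If $\mathrm{rk}(M)=0$, then $Z^{\mathrm{top}}_M(s)=1$. If $\mathrm{rk}(M)=r>0$ and $|E|=n$, then $$Z^{\mathrm{top}}_M(s)=\frac{1}{ns+r}\sum_{F\in\mathcal{L}(M),\ F\neq E}Z^{\mathrm{top}}_{M|_F}(s)\,\overline{\chi}_{M/F}(1).$$ This rational function has no pole at $s=0$, so it has a power series expansion at $s=0$. *)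

theory Defs
  imports
    "HOL-Computational_Algebra.Computational_Algebra"
    "HOL-Computational_Algebra.Field_as_Ring"
begin

section \<open>Matroids on a finite ground set\<close>

definition independence_system :: "'a set \<Rightarrow> 'a set set \<Rightarrow> bool" where
  "independence_system E I \<longleftrightarrow>
     finite E \<and> (\<forall>X\<in>I. X \<subseteq> E) \<and> {} \<in> I \<and>
     (\<forall>X\<in>I. \<forall>Y. Y \<subseteq> X \<longrightarrow> Y \<in> I) \<and>
     (\<forall>X\<in>I. \<forall>Y\<in>I. card X < card Y \<longrightarrow> (\<exists>y\<in>Y - X. insert y X \<in> I))"

typedef 'a matroid = "{(E :: 'a set, I). independence_system E I}"
  by (rule exI[of _ "({}, {{}})"]) (auto simp: independence_system_def)

definition ground :: "'a matroid \<Rightarrow> 'a set" where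
  "ground M = fst (Rep_matroid M)"

definition indep :: "'a matroid \<Rightarrow> 'a set \<Rightarrow> bool" where
  "indep M X \<longleftrightarrow> X \<in> snd (Rep_matroid M)"

lemma independence_system_Rep: "independence_system (ground M) {X. indep M X}"
  using Rep_matroid[of M] by (auto simp: ground_def indep_def)

lemma
  assumes "independence_system E I"
  shows ground_Abs: "ground (Abs_matroid (E, I)) = E"
    and indep_Abs: "indep (Abs_matroid (E, I)) X \<longleftrightarrow> X \<in> I"
  using assms by (simp_all add: ground_def indep_def Abs_matroid_inverse)

lemma finite_ground [simp]: "finite (ground M)"
  using independence_system_Rep[of M] by (simp add: independence_system_def)

lemma indep_subset_ground: "indep M X \<Longrightarrow> X \<subseteq> ground M"
  using independence_system_Rep[of M] by (simp add: independence_system_def)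

lemma indep_empty [simp]: "indep M {}"
  using independence_system_Rep[of M] by (simp add: independence_system_def)

lemma indep_mono: "indep M X \<Longrightarrow> Y \<subseteq> X \<Longrightarrow> indep M Y"
  using independence_system_Rep[of M] unfolding independence_system_def by blast

lemma indep_augment:
  "indep M X \<Longrightarrow> indep M Y \<Longrightarrow> card X < card Y \<Longrightarrow> \<exists>y\<in>Y - X. indep M (insert y X)"
  using independence_system_Rep[of M] unfolding independence_system_def by simp

lemma finite_indep: "indep M X \<Longrightarrow> finite X"
  using finite_subset[OF indep_subset_ground finite_ground] .

text \<open>The sets \<open>S\<close> below need not be contained in the ground set; elements outside it
  belong to no independent set, so they behave as loops.\<close>

definition basis_of :: "'a matroid \<Rightarrow> 'a set \<Rightarrow> 'a set \<Rightarrow> bool" where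
  "basis_of M S B \<longleftrightarrow> B \<subseteq> S \<and> indep M B \<and> (\<forall>x\<in>S - B. \<not> indep M (insert x B))"

definition rank_of :: "'a matroid \<Rightarrow> 'a set \<Rightarrow> nat" where
  "rank_of M S = Max (card ` {X. X \<subseteq> S \<and> indep M X})"

definition rank :: "'a matroid \<Rightarrow> nat" where
  "rank M = rank_of M (ground M)"

lemma finite_indeps: "finite {X. X \<subseteq> S \<and> indep M X}"
  by (rule finite_subset[of _ "Pow (ground M)"]) (auto dest: indep_subset_ground)

lemma basis_of_exists: "\<exists>B. basis_of M S B"
proof -
  define A where "A = card ` {X. X \<subseteq> S \<and> indep M X}"
  have A: "finite A" "A \<noteq> {}"
    unfolding A_def using finite_indeps[of S M] by (auto intro: exI[of _ "{}"])
  obtain B where B: "B \<subseteq> S" "indep M B" "card B = Max A"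
    using Max_in[OF A] unfolding A_def by auto
  have "\<not> indep M (insert x B)" if "x \<in> S - B" for x
  proof
    assume "indep M (insert x B)"
    hence "card (insert x B) \<in> A" unfolding A_def using that B by blast
    hence "card (insert x B) \<le> card B" using A B by simp
    thus False using that finite_indep[OF B(2)] by simp
  qed
  thus ?thesis using B unfolding basis_of_def by blast
qed

lemma basis_of_card_le:
  assumes "basis_of M S B" "basis_of M S B'"
  shows "card B \<le> card B'"
proof (rule ccontr)
  assume "\<not> card B \<le> card B'"
  then obtain y where "y \<in> B - B'" "indep M (insert y B')"
    using indep_augment[of M B' B] assms unfolding basis_of_def by auto
  thus False using assms unfolding basis_of_def by blast
qed

definition restriction :: "'a matroid \<Rightarrow> 'a set \<Rightarrow> 'a matroid" where
  "restriction M F = Abs_matroid (ground M \<inter> F, {X. X \<subseteq> F \<and> indep M X})"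

lemma independence_system_restriction:
  "independence_system (ground M \<inter> F) {X. X \<subseteq> F \<and> indep M X}"
  unfolding independence_system_def
proof (intro conjI ballI allI impI)
  fix X Y assume "X \<in> {X. X \<subseteq> F \<and> indep M X}" "Y \<in> {X. X \<subseteq> F \<and> indep M X}" "card X < card Y"
  thus "\<exists>y\<in>Y - X. insert y X \<in> {X. X \<subseteq> F \<and> indep M X}"
    using indep_augment[of M X Y] by blast
qed (auto dest: indep_subset_ground intro: indep_mono)

lemmas ground_restriction [simp] =
  ground_Abs[OF independence_system_restriction, folded restriction_def]
lemmas indep_restriction_iff =
  indep_Abs[OF independence_system_restriction, folded restriction_def, unfolded mem_Collect_eq]

definition contraction :: "'a matroid \<Rightarrow> 'a set \<Rightarrow> 'a matroid" where
  "contraction M F = Abs_matroid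
     (ground M - F, {X. X \<subseteq> ground M - F \<and> (\<exists>B. basis_of M F B \<and> indep M (X \<union> B))})"

lemma independence_system_contraction:
  "independence_system (ground M - F)
     {X. X \<subseteq> ground M - F \<and> (\<exists>B. basis_of M F B \<and> indep M (X \<union> B))}"
  (is "independence_system _ ?I")
  unfolding independence_system_def
proof (intro conjI ballI allI impI)
  show "{} \<in> ?I" using basis_of_exists[of M F] by (auto simp: basis_of_def)
next
  fix X Y assume XY: "X \<in> ?I" "Y \<subseteq> X"
  then obtain B where "basis_of M F B" "indep M (X \<union> B)" by blast
  moreover have "indep M (Y \<union> B)" using \<open>indep M (X \<union> B)\<close> by (rule indep_mono) (use XY in blast)
  ultimately show "Y \<in> ?I" using XY by blast
next
  fix X Y assume X: "X \<in> ?I" and Y: "Y \<in> ?I" and less: "card X < card Y"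
  obtain B where B: "basis_of M F B" "indep M (X \<union> B)" using X by blast
  obtain B' where B': "basis_of M F B'" "indep M (Y \<union> B')" using Y by blast
  have sub: "B \<subseteq> F" "B' \<subseteq> F" using B(1) B'(1) by (auto simp: basis_of_def)
  have fin: "finite X" "finite Y" "finite B" "finite B'"
    using finite_indep[OF B(2)] finite_indep[OF B'(2)] by auto
  have "X \<inter> B = {}" "Y \<inter> B' = {}" using X Y sub by blast+
  hence "card (X \<union> B) = card X + card B" "card (Y \<union> B') = card Y + card B'"
    using fin by (simp_all add: card_Un_disjoint)
  moreover have "card B \<le> card B'" using basis_of_card_le B(1) B'(1) by blast
  ultimately have "card (X \<union> B) < card (Y \<union> B')" using less by linarith
  then obtain y where y: "y \<in> (Y \<union> B') - (X \<union> B)" "indep M (insert y (X \<union> B))"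
    using indep_augment[OF B(2) B'(2)] by blast
  have "y \<notin> B'"
  proof
    assume "y \<in> B'"
    moreover have "indep M (insert y B)" using y(2) by (rule indep_mono) auto
    ultimately show False using y(1) B(1) sub unfolding basis_of_def by blast
  qed
  hence yYX: "y \<in> Y - X" using y by blast
  have "indep M (insert y X \<union> B)" using y by simp
  hence "insert y X \<in> ?I" using X Y B(1) yYX by blast
  thus "\<exists>y\<in>Y - X. insert y X \<in> ?I" using yYX by blast
qed auto

lemmas ground_contraction [simp] =
  ground_Abs[OF independence_system_contraction, folded contraction_def]
lemmas indep_contraction_iff =
  indep_Abs[OF independence_system_contraction, folded contraction_def, unfolded mem_Collect_eq]

definition circuit :: "'a matroid \<Rightarrow> 'a set \<Rightarrow> bool" where
  "circuit M C \<longleftrightarrow> C \<subseteq> ground M \<and> \<not> indep M C \<and> (\<forall>D. D \<subset> C \<longrightarrow> indep M D)"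

definition loopless :: "'a matroid \<Rightarrow> bool" where
  "loopless M \<longleftrightarrow> (\<forall>x\<in>ground M. indep M {x})"

definition simple_matroid :: "'a matroid \<Rightarrow> bool" where
  "simple_matroid M \<longleftrightarrow> loopless M \<and> (\<forall>x\<in>ground M. \<forall>y\<in>ground M. x \<noteq> y \<longrightarrow> indep M {x, y})"

definition flat :: "'a matroid \<Rightarrow> 'a set \<Rightarrow> bool" where
  "flat M F \<longleftrightarrow> F \<subseteq> ground M \<and> (\<forall>x\<in>ground M - F. rank_of M F < rank_of M (insert x F))"

lemma flat_subset_ground: "flat M F \<Longrightarrow> F \<subseteq> ground M"
  by (simp add: flat_def)

lemma finite_flat: "flat M F \<Longrightarrow> finite F"
  using finite_subset[OF flat_subset_ground finite_ground] .


section \<open>Characteristic polynomials\<close>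

function moebius :: "'a matroid \<Rightarrow> 'a set \<Rightarrow> 'a set \<Rightarrow> int" where
  "moebius M F G =
     (if flat M F \<and> flat M G \<and> F \<subseteq> G
      then if F = G then 1
           else - (\<Sum>H\<in>{H. flat M H \<and> F \<subseteq> H \<and> H \<subset> G}. moebius M F H)
      else 0)"
  by pat_completeness auto
termination
  by (relation "measure (\<lambda>(M, F, G). card G)")
     (auto intro: psubset_card_mono dest: finite_flat)

declare moebius.simps [simp del]

definition charpoly :: "'a matroid \<Rightarrow> int poly" where
  "charpoly M = (\<Sum>F\<in>{F. flat M F}. monom (moebius M {} F) (rank M - rank_of M F))"

text \<open>For a loopless matroid of positive rank the division by \<open>x - 1\<close> is exact.\<close>

definition reduced_charpoly :: "'a matroid \<Rightarrow> int poly" where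
  "reduced_charpoly M = charpoly M div [:-1, 1:]"


section \<open>Rational functions and the topological zeta function\<close>

text \<open>The field of rational functions in one variable \<open>s\<close> over the rationals is
  \<open>rat poly fract\<close>; it embeds into the field of Laurent series at \<open>s = 0\<close>.
  For a rational function without a pole at \<open>s = 0\<close>, the Laurent series is its power series
  expansion; that \<open>zeta_top M\<close> has no such pole is lemma \<open>zeta_top_no_pole\<close>.\<close>

definition expansion_at_0 :: "rat poly fract \<Rightarrow> rat fls" where
  "expansion_at_0 x =
     (case quot_of_fract x of (p, q) \<Rightarrow> fps_to_fls (fps_of_poly p) / fps_to_fls (fps_of_poly q))"

function zeta_top :: "'a matroid \<Rightarrow> rat poly fract" where
  "zeta_top M =
     (if rank M = 0 then 1
      else Fract 1 [:of_nat (rank M), of_nat (card (ground M)):] *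
           (\<Sum>F\<in>{F. flat M F \<and> F \<noteq> ground M}.
              zeta_top (restriction M F) * of_int (poly (reduced_charpoly (contraction M F)) 1)))"
  by pat_completeness auto
termination
  by (relation "measure (\<lambda>M. card (ground M))")
     (auto intro!: psubset_card_mono dest: flat_subset_ground)

declare zeta_top.simps [simp del]

lemma fps_to_fls_of_poly_eq_0_iff [simp]: "fps_to_fls (fps_of_poly p) = 0 \<longleftrightarrow> p = 0"
  by (metis fps_of_poly_0 fps_of_poly_eq_iff fps_to_fls_eq_iff fps_zero_to_fls)

lemma expansion_at_0_Fract:
  assumes "q \<noteq> 0"
  shows "expansion_at_0 (Fract p q) = fps_to_fls (fps_of_poly p) / fps_to_fls (fps_of_poly q)"
proof -
  obtain p' q' where pq: "quot_of_fract (Fract p q) = (p', q')" by fastforce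
  have nz: "q' \<noteq> 0" using snd_quot_of_fract_nonzero[of "Fract p q"] pq by simp
  have "Fract p' q' = Fract p q" using Fract_quot_of_fract[of "Fract p q"] pq by simp
  hence "p' * q = p * q'" using assms nz by (simp add: eq_fract)
  thus ?thesis
    using assms nz by (simp add: expansion_at_0_def pq frac_eq_eq
      flip: fls_times_fps_to_fls fps_of_poly_mult)
qed

lemma expansion_at_0_0 [simp]: "expansion_at_0 0 = 0"
  by (simp add: Zero_fract_def expansion_at_0_Fract)

lemma expansion_at_0_1 [simp]: "expansion_at_0 1 = 1"
  by (simp add: One_fract_def expansion_at_0_Fract)

lemma expansion_at_0_mult: "expansion_at_0 (x * y) = expansion_at_0 x * expansion_at_0 y"
  by (cases x rule: Fract_cases; cases y rule: Fract_cases)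
     (simp add: expansion_at_0_Fract fps_of_poly_mult fls_times_fps_to_fls)

lemma expansion_at_0_add: "expansion_at_0 (x + y) = expansion_at_0 x + expansion_at_0 y"
  by (cases x rule: Fract_cases; cases y rule: Fract_cases)
     (simp add: expansion_at_0_Fract fps_of_poly_mult fps_of_poly_add fls_times_fps_to_fls
        fps_to_fls_plus add_frac_eq)

lemma expansion_at_0_sum: "expansion_at_0 (\<Sum>i\<in>A. f i) = (\<Sum>i\<in>A. expansion_at_0 (f i))"
  by (induction A rule: infinite_finite_induct) (simp_all add: expansion_at_0_add)

lemma expansion_at_0_of_int [simp]: "expansion_at_0 (of_int k) = of_int k"
proof -
  have nat: "expansion_at_0 (of_nat m) = of_nat m" for m
    by (induction m) (simp_all add: expansion_at_0_add)
  have "expansion_at_0 (- of_nat m) = - of_nat m" for m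
    using expansion_at_0_add[of "- of_nat m" "of_nat m"] by (simp add: nat eq_neg_iff_add_eq_0)
  thus ?thesis using nat by (cases k rule: int_cases2) simp_all
qed

lemma fps_to_fls_sum: "fps_to_fls (\<Sum>i\<in>A. f i) = (\<Sum>i\<in>A. fps_to_fls (f i))"
  by (induction A rule: infinite_finite_induct) simp_all

lemma zeta_top_no_pole: "\<exists>f. expansion_at_0 (zeta_top M) = fps_to_fls f"
proof (induction M rule: zeta_top.induct)
  case (1 M)
  show ?case
  proof (cases "rank M = 0")
    case True
    thus ?thesis by (intro exI[of _ 1]) (simp add: zeta_top.simps)
  next
    case False
    define A where "A = {F. flat M F \<and> F \<noteq> ground M}"
    define d :: "rat poly" where "d = [:of_nat (rank M), of_nat (card (ground M)):]"
    have d: "d \<noteq> 0" "subdegree (fps_of_poly d) = 0" using False by (simp_all add: d_def)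
    have "\<forall>F\<in>A. \<exists>f. expansion_at_0 (zeta_top (restriction M F)) = fps_to_fls f"
      using 1 False by (auto simp: A_def)
    then obtain f where f: "\<And>F. F \<in> A \<Longrightarrow> expansion_at_0 (zeta_top (restriction M F)) = fps_to_fls (f F)"
      by metis
    have "expansion_at_0 (zeta_top M) = fps_to_fls (inverse (fps_of_poly d)) *
        (\<Sum>F\<in>A. fps_to_fls (f F) * fps_to_fls (of_int (poly (reduced_charpoly (contraction M F)) 1)))"
      using False d f
      by (subst zeta_top.simps)
         (simp add: expansion_at_0_mult expansion_at_0_sum expansion_at_0_Fract
            fls_inverse_fps_to_fls divide_inverse fps_of_int flip: A_def d_def)
    also have "\<dots> = fps_to_fls (inverse (fps_of_poly d) *
        (\<Sum>F\<in>A. f F * of_int (poly (reduced_charpoly (contraction M F)) 1)))"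
      by (simp add: fls_times_fps_to_fls fps_to_fls_sum)
    finally show ?thesis by blast
  qed
qed

end

theory Submission
  imports Defs
begin

text \<open>Since \<open>\<chi>_{M/F}\<close> vanishes at 1 for \<open>F \<noteq> E\<close>, its reduced version takes there the value
  \<open>b(F) = \<Sum>G\<supseteq>F. \<mu>(F,G) (rk M - rk G)\<close>, and Moebius inversion gives
  \<open>(\<Sum>F\<supseteq>X. b(F)) = rk M - rk X\<close> for every \<open>X \<subseteq> E\<close>, the sums running over flats. Comparing coefficients of \<open>s^k\<close> in the
  recursion, \<open>r z_k(M) + n z_{k-1}(M) = (\<Sum>F. z_k(M|F) b(F))\<close>, so whenever \<open>z_k(M|F)\<close> is a sum
  of weights over subsets \<open>X\<close> of \<open>F\<close> the right-hand side replaces each weight \<open>w(X)\<close> by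
  \<open>w(X) (r - rk X)\<close>. By induction \<open>z_0 = 1\<close>, \<open>z_1 = -n\<close> and
  \<open>z_2 = (\<Sum>x y. 1 / rk {x, y})\<close>, where a pair contributes 1 if it is equal or parallel and 1/2
  otherwise.\<close>

section \<open>Rank and closure\<close>

lemma card_le_rank_of: "X \<subseteq> S \<Longrightarrow> indep M X \<Longrightarrow> card X \<le> rank_of M S"
  unfolding rank_of_def using finite_indeps[of S M] by (intro Max_ge) auto

text \<open>Augmentation: an independent subset of \<open>S\<close> larger than \<open>B\<close>
  would supply an element that still extends \<open>B\<close>.\<close>

lemma rank_of_basis:
  assumes "basis_of M S B"
  shows "rank_of M S = card B"
proof (rule antisym)
  have "rank_of M S \<in> card ` {X. X \<subseteq> S \<and> indep M X}"
    unfolding rank_of_def using finite_indeps[of S M] by (intro Max_in) (auto intro: exI[of _ "{}"])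
  then obtain X where X: "X \<subseteq> S" "indep M X" "rank_of M S = card X" by auto
  show "rank_of M S \<le> card B"
  proof (rule ccontr)
    assume "\<not> rank_of M S \<le> card B"
    then obtain y where "y \<in> X - B" "indep M (insert y B)"
      using indep_augment[of M B X] assms X unfolding basis_of_def by auto
    thus False using assms X unfolding basis_of_def by blast
  qed
  show "card B \<le> rank_of M S"
    using assms by (intro card_le_rank_of) (auto simp: basis_of_def)
qed

lemma basis_extend:
  assumes "indep M B" "B \<subseteq> S"
  obtains B' where "basis_of M S B'" "B \<subseteq> B'"
proof -
  define A where "A = {X. X \<subseteq> S \<and> indep M X}"
  have "finite A" "B \<in> A" using finite_indeps[of S M] assms by (auto simp: A_def)
  then obtain B' where B': "B' \<in> A" "B \<subseteq> B'" "\<And>X. X \<in> A \<Longrightarrow> B' \<subseteq> X \<Longrightarrow> B' = X"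
    using finite_has_maximal2[of A B] by auto
  have "\<not> indep M (insert x B')" if "x \<in> S - B'" for x
    using B'(3)[of "insert x B'"] B'(1) that by (auto simp: A_def)
  hence "basis_of M S B'" using B'(1) by (auto simp: A_def basis_of_def)
  thus ?thesis using B'(2) that by blast
qed

lemma rank_of_mono:
  assumes "X \<subseteq> Y"
  shows "rank_of M X \<le> rank_of M Y"
proof -
  obtain B where B: "basis_of M X B" using basis_of_exists by blast
  hence "card B \<le> rank_of M Y"
    using assms by (intro card_le_rank_of) (auto simp: basis_of_def)
  thus ?thesis using rank_of_basis[OF B] by simp
qed

lemma rank_of_indep: "indep M X \<Longrightarrow> rank_of M X = card X"
  by (intro rank_of_basis) (auto simp: basis_of_def)

lemma rank_of_empty [simp]: "rank_of M {} = 0"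
  by (simp add: rank_of_indep)

lemma flat_ground [simp]: "flat M (ground M)"
  by (simp add: flat_def)

lemma finite_flats [simp]: "finite {F. flat M F}"
  by (rule finite_subset[of _ "Pow (ground M)"]) (auto simp: flat_def)

text \<open>What a flat does not span, its subsets do not span either: a basis of \<open>X\<close>
  extends to a basis of \<open>F\<close>, and \<open>z\<close> is independent of the latter, hence
  of the former.\<close>

lemma rank_of_insert_flat:
  assumes "flat M F" "X \<subseteq> F" "z \<in> ground M - F"
  shows "rank_of M X < rank_of M (insert z X)"
proof -
  obtain B where B: "basis_of M X B" using basis_of_exists by blast
  then obtain B' where B': "basis_of M F B'" "B \<subseteq> B'"
    using basis_extend[of M B F] assms(2) unfolding basis_of_def by blast
  have "indep M (insert z B')"
  proof (rule ccontr)
    assume "\<not> indep M (insert z B')"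
    hence "basis_of M (insert z F) B'" using B' by (auto simp: basis_of_def)
    hence "rank_of M (insert z F) = rank_of M F" using B'(1) by (simp add: rank_of_basis)
    thus False using assms(1,3) unfolding flat_def by (metis less_irrefl)
  qed
  hence "indep M (insert z B)" using B'(2) by (blast intro: indep_mono)
  hence "card (insert z B) \<le> rank_of M (insert z X)"
    using B by (intro card_le_rank_of) (auto simp: basis_of_def)
  moreover have "z \<notin> B" "finite B"
    using assms B finite_indep by (auto simp: basis_of_def)
  ultimately show ?thesis using rank_of_basis[OF B] by simp
qed

text \<open>\<open>K\<close> is the closure of \<open>X\<close>, found as a maximal superset of the
  same rank. The last property lets sums over flats containing an arbitrary \<open>X\<close> be
  treated as sums over flats above a flat.\<close>

lemma closure_exists:
  assumes "X \<subseteq> ground M"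
  obtains K where "flat M K" "rank_of M K = rank_of M X"
    "\<And>F. flat M F \<Longrightarrow> K \<subseteq> F \<longleftrightarrow> X \<subseteq> F"
proof -
  define A where "A = {Y. X \<subseteq> Y \<and> Y \<subseteq> ground M \<and> rank_of M Y = rank_of M X}"
  have "finite A" by (rule finite_subset[of _ "Pow (ground M)"]) (auto simp: A_def)
  moreover have "X \<in> A" using assms by (auto simp: A_def)
  ultimately obtain K where K: "K \<in> A" "\<And>Y. Y \<in> A \<Longrightarrow> K \<subseteq> Y \<Longrightarrow> K = Y"
    using finite_has_maximal2[of A X] by auto
  have XK: "X \<subseteq> K" "K \<subseteq> ground M" "rank_of M K = rank_of M X"
    using K(1) by (auto simp: A_def)
  have "rank_of M K < rank_of M (insert x K)" if "x \<in> ground M - K" for x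
  proof -
    have "insert x K \<notin> A" using K(2)[of "insert x K"] that by blast
    hence "rank_of M (insert x K) \<noteq> rank_of M K" using that XK by (auto simp: A_def)
    moreover have "rank_of M K \<le> rank_of M (insert x K)" by (intro rank_of_mono) auto
    ultimately show ?thesis by linarith
  qed
  hence "flat M K" using XK by (simp add: flat_def)
  moreover have KF: "K \<subseteq> F" if "flat M F" "X \<subseteq> F" for F
  proof
    fix z assume z: "z \<in> K"
    show "z \<in> F"
    proof (rule ccontr)
      assume "z \<notin> F"
      \<comment> \<open>But \<open>insert z X\<close> lies in \<open>K\<close>, whose rank is that
        of \<open>X\<close>.\<close>
      hence "rank_of M X < rank_of M (insert z X)"
        using rank_of_insert_flat[OF that, of z] z XK by blast
      also have "\<dots> \<le> rank_of M K" using z XK by (intro rank_of_mono) auto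
      finally show False using XK by simp
    qed
  qed
  moreover have "K \<subseteq> F \<longleftrightarrow> X \<subseteq> F" if "flat M F" for F
    using KF[OF that] XK(1) by (meson subset_trans)
  ultimately show ?thesis using that XK(3) by simp
qed

lemma rank_of_pair:
  assumes "loopless M" "x \<in> ground M" "y \<in> ground M"
  shows "rank_of M {x, y} = (if x \<noteq> y \<and> indep M {x, y} then 2 else 1)"
proof (cases "indep M {x, y}")
  case True
  thus ?thesis by (auto simp: rank_of_indep)
next
  case False
  moreover have "indep M {x}" using assms by (simp add: loopless_def)
  ultimately have "basis_of M {x, y} {x}" by (auto simp: basis_of_def insert_commute)
  thus ?thesis using False by (simp add: rank_of_basis)
qed

lemma rank_of_singleton: "loopless M \<Longrightarrow> x \<in> ground M \<Longrightarrow> rank_of M {x} = 1"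
  using rank_of_pair[of M x x] by simp

section \<open>Restriction and contraction\<close>

lemma loopless_restriction: "loopless M \<Longrightarrow> loopless (restriction M F)"
  by (auto simp: loopless_def indep_restriction_iff)

lemma rank_of_restriction: "X \<subseteq> F \<Longrightarrow> rank_of (restriction M F) X = rank_of M X"
  unfolding rank_of_def indep_restriction_iff
  by (rule arg_cong[where f = "\<lambda>A. Max (card ` A)"]) auto

text \<open>Bases of \<open>H\<close> in the contraction and of \<open>F\<close> in \<open>M\<close>
  together form a basis of the union. The additive form avoids truncated subtraction.\<close>

lemma rank_of_contraction:
  assumes "H \<subseteq> ground M - F"
  shows "rank_of (contraction M F) H + rank_of M F = rank_of M (H \<union> F)"
proof (rule antisym)
  obtain X where X: "basis_of (contraction M F) H X" using basis_of_exists by blast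
  then obtain B where B: "basis_of M F B" "indep M (X \<union> B)"
    by (auto simp: basis_of_def indep_contraction_iff)
  have "X \<inter> B = {}" using X B assms by (auto simp: basis_of_def)
  hence "card (X \<union> B) = card X + card B"
    using finite_indep[OF B(2)] by (simp add: card_Un_disjoint)
  moreover have "card (X \<union> B) \<le> rank_of M (H \<union> F)"
    using X B by (intro card_le_rank_of) (auto simp: basis_of_def)
  ultimately show "rank_of (contraction M F) H + rank_of M F \<le> rank_of M (H \<union> F)"
    using rank_of_basis[OF X] rank_of_basis[OF B(1)] by simp
next
  obtain B where B: "basis_of M F B" using basis_of_exists by blast
  then obtain B' where B': "basis_of M (H \<union> F) B'" "B \<subseteq> B'"
    using basis_extend[of M B "H \<union> F"] unfolding basis_of_def by blast
  \<comment> \<open>\<open>B\<close> is already maximal in \<open>F\<close>, so its extension only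
    adds elements outside \<open>F\<close>.\<close>
  have "B' \<inter> F \<subseteq> B"
  proof
    fix z assume z: "z \<in> B' \<inter> F"
    have "indep M (insert z B)"
      by (rule indep_mono[of M B']) (use B' z in \<open>auto simp: basis_of_def\<close>)
    thus "z \<in> B" using B z by (auto simp: basis_of_def)
  qed
  hence eq: "(B' - F) \<union> B = B'" "(B' - F) \<inter> B = {}"
    using B B'(2) by (auto simp: basis_of_def)
  have "B' - F \<subseteq> H" "indep M B'" using B' by (auto simp: basis_of_def)
  hence "indep (contraction M F) (B' - F)"
    using B eq(1) assms by (auto simp: indep_contraction_iff intro!: exI[of _ B])
  hence "card (B' - F) \<le> rank_of (contraction M F) H"
    using \<open>B' - F \<subseteq> H\<close> by (intro card_le_rank_of)
  moreover have "card B' = card (B' - F) + card B"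
    using eq finite_indep[OF \<open>indep M B'\<close>] by (metis card_Un_disjoint finite_Un)
  ultimately show "rank_of M (H \<union> F) \<le> rank_of (contraction M F) H + rank_of M F"
    using rank_of_basis[OF B'(1)] rank_of_basis[OF B] by simp
qed

lemma flat_contraction_iff:
  assumes "F \<subseteq> ground M"
  shows "flat (contraction M F) H \<longleftrightarrow> H \<subseteq> ground M - F \<and> flat M (H \<union> F)"
proof (cases "H \<subseteq> ground M - F")
  case True
  have "rank_of (contraction M F) H < rank_of (contraction M F) (insert x H) \<longleftrightarrow>
        rank_of M (H \<union> F) < rank_of M (insert x (H \<union> F))"
    if "x \<in> ground M - F - H" for x
    using rank_of_contraction[OF True] rank_of_contraction[of "insert x H" M F] that True
    by (simp flip: add_less_cancel_right[of "rank_of (contraction M F) _" "rank_of M F"])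
  thus ?thesis using True assms by (auto simp: flat_def)
qed (auto simp: flat_def)

lemma bij_betw_flats_contraction:
  assumes "F \<subseteq> ground M"
  shows "bij_betw (\<lambda>G. G - F) {G. flat M G \<and> F \<subseteq> G} {H. flat (contraction M F) H}"
  using assms
  by (intro bij_betw_byWitness[where f' = "\<lambda>H. H \<union> F"])
     (auto simp: flat_contraction_iff Un_absorb2 Diff_Un dest: flat_subset_ground)

text \<open>The recursion for the Moebius function sees only the interval from \<open>F\<close> to
  \<open>G\<close>, and removing \<open>F\<close> maps it isomorphically onto an interval of flats
  of the contraction.\<close>

lemma moebius_contraction:
  assumes "F \<subseteq> G" "F \<subseteq> ground M"
  shows "moebius (contraction M F) {} (G - F) = moebius M F G"
  using assms(1)
proof (induction "card G" arbitrary: G rule: less_induct)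
  case less
  show ?case
  proof (cases "flat M F \<and> flat M G")
    case False
    \<comment> \<open>Both sides take the default value 0, since flatness transfers in either
      argument.\<close>
    thus ?thesis using less.prems assms(2)
      by (auto simp: moebius.simps flat_contraction_iff Un_absorb2)
  next
    case True
    have flats: "flat (contraction M F) {}" "flat (contraction M F) (G - F)"
      using True less.prems assms(2)
      by (auto simp: flat_contraction_iff Un_absorb2 dest: flat_subset_ground)
    have "bij_betw (\<lambda>G. G - F) {H. flat M H \<and> F \<subseteq> H \<and> H \<subset> G}
            {H. flat (contraction M F) H \<and> {} \<subseteq> H \<and> H \<subset> G - F}"
      using assms(2) less.prems
      by (intro bij_betw_byWitness[where f' = "\<lambda>H. H \<union> F"])
         (auto simp: flat_contraction_iff Un_absorb2 dest: flat_subset_ground)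
    hence "(\<Sum>H\<in>{H. flat (contraction M F) H \<and> {} \<subseteq> H \<and> H \<subset> G - F}.
              moebius (contraction M F) {} H) =
           (\<Sum>H\<in>{H. flat M H \<and> F \<subseteq> H \<and> H \<subset> G}. moebius (contraction M F) {} (H - F))"
      by (rule sum.reindex_bij_betw[symmetric])
    also have "\<dots> = (\<Sum>H\<in>{H. flat M H \<and> F \<subseteq> H \<and> H \<subset> G}. moebius M F H)"
      using True by (intro sum.cong refl less.hyps) (auto intro: psubset_card_mono dest: finite_flat)
    finally show ?thesis using True flats less.prems
      by (subst (1 2) moebius.simps) auto
  qed
qed

section \<open>Moebius inversion on the lattice of flats\<close>

lemma moebius_refl [simp]: "flat M F \<Longrightarrow> moebius M F F = 1"
  by (simp add: moebius.simps)

lemma sum_moebius: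
  assumes "flat M F" "flat M G" "F \<subseteq> G"
  shows "(\<Sum>H\<in>{H. flat M H \<and> F \<subseteq> H \<and> H \<subseteq> G}. moebius M F H) = (if F = G then 1 else 0)"
proof (cases "F = G")
  case True
  hence "{H. flat M H \<and> F \<subseteq> H \<and> H \<subseteq> G} = {G}" using assms by auto
  thus ?thesis using True assms by simp
next
  case False
  have "{H. flat M H \<and> F \<subseteq> H \<and> H \<subseteq> G} = insert G {H. flat M H \<and> F \<subseteq> H \<and> H \<subset> G}"
    using assms by auto
  moreover have "finite {H. flat M H \<and> F \<subseteq> H \<and> H \<subset> G}"
    by (rule finite_subset[OF _ finite_flats[of M]]) auto
  moreover have "moebius M F G = - (\<Sum>H\<in>{H. flat M H \<and> F \<subseteq> H \<and> H \<subset> G}. moebius M F H)"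
    using assms False by (subst moebius.simps) simp
  ultimately show ?thesis using False by simp
qed

text \<open>The two sides have the same transform under the unitriangular kernel
  \<open>\<lambda>K F. moebius M K F\<close>; this avoids the dual identity for \<open>\<Sum>H. moebius M H G\<close>.\<close>

lemma moebius_inversion:
  fixes M :: "'a matroid" and h :: "'a set \<Rightarrow> int"
  defines "b \<equiv> \<lambda>F. \<Sum>G\<in>{G. flat M G \<and> F \<subseteq> G}. moebius M F G * h G"
  assumes "flat M K"
  shows "(\<Sum>F\<in>{F. flat M F \<and> K \<subseteq> F}. b F) = h K"
  using assms(2)
proof (induction "card (ground M - K)" arbitrary: K rule: less_induct)
  case less
  define S where "S = (\<lambda>X. \<Sum>F\<in>{F. flat M F \<and> X \<subseteq> F}. b F)"
  have fin [simp]: "finite {F. flat M F \<and> P F}" for P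
    by (rule finite_subset[OF _ finite_flats[of M]]) auto
  \<comment> \<open>The induction descends from the ground set, so flats strictly above
    \<open>K\<close> are settled.\<close>
  have above: "S G = h G" if "flat M G" "K \<subset> G" for G
    unfolding S_def using that
    by (intro less.hyps psubset_card_mono) (auto dest: flat_subset_ground)
  have "(\<Sum>G\<in>{G. flat M G \<and> K \<subseteq> G}. moebius M K G * S G) =
        (\<Sum>G\<in>{G. flat M G \<and> K \<subseteq> G}. \<Sum>F\<in>{F. flat M F \<and> G \<subseteq> F}. moebius M K G * b F)"
    by (simp add: S_def sum_distrib_left)
  \<comment> \<open>Exchange the order over chains \<open>K\<close>, \<open>G\<close>,
    \<open>F\<close>; the inner sum is then the one in \<open>sum_moebius\<close> and leaves only
    \<open>F = K\<close>.\<close>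
  also have "\<dots> = (\<Sum>F\<in>{F. flat M F \<and> K \<subseteq> F}.
      \<Sum>G\<in>{G. flat M G \<and> K \<subseteq> G \<and> G \<subseteq> F}. moebius M K G * b F)"
    by (subst sum.Sigma, simp, simp, subst sum.Sigma, simp, simp,
        rule sum.reindex_bij_witness[where i = prod.swap and j = prod.swap]) auto
  also have "\<dots> = (\<Sum>F\<in>{F. flat M F \<and> K \<subseteq> F}. if K = F then b F else 0)"
    using less.prems by (intro sum.cong refl) (simp add: sum_moebius flip: sum_distrib_right)
  also have "\<dots> = b K" using less.prems by (simp add: sum.delta)
  finally have "(\<Sum>G\<in>{G. flat M G \<and> K \<subseteq> G}. moebius M K G * (S G - h G)) = 0"
    by (simp add: right_diff_distrib sum_subtractf b_def)
  \<comment> \<open>Only \<open>G = K\<close> survives, with coefficient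
    \<open>moebius M K K = 1\<close>.\<close>
  also have "(\<Sum>G\<in>{G. flat M G \<and> K \<subseteq> G}. moebius M K G * (S G - h G)) =
      (\<Sum>G\<in>{G. flat M G \<and> K \<subseteq> G}. if K = G then S K - h K else 0)"
    using above less.prems by (intro sum.cong refl) (auto simp: psubset_eq)
  also have "\<dots> = S K - h K" using less.prems by (simp add: sum.delta)
  finally show ?case by (simp add: S_def)
qed

section \<open>The reduced characteristic polynomial at 1\<close>

text \<open>By the product rule, \<open>(x - a) * q\<close> has derivative \<open>q(a)\<close> at
  \<open>a\<close>. This replaces the division in \<open>reduced_charpoly\<close> by a
  derivative.\<close>

lemma poly_div_linear_eq_pderiv:
  fixes p :: "'a :: idom_modulo poly"
  assumes "poly p a = 0"
  shows "poly (p div [:-a, 1:]) a = poly (pderiv p) a"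
proof -
  obtain q where q: "p = [:-a, 1:] * q" using assms by (auto simp: poly_eq_0_iff_dvd)
  have "p div [:-a, 1:] = q" unfolding q by (rule nonzero_mult_div_cancel_left) simp
  thus ?thesis by (simp add: q pderiv_mult pderiv_pCons del: mult_pCons_left)
qed

text \<open>In the exponent the two occurrences of \<open>rank_of M F\<close> cancel, leaving only
  ranks in \<open>M\<close>.\<close>

lemma charpoly_contraction:
  assumes "flat M F"
  shows "charpoly (contraction M F) =
    (\<Sum>G\<in>{G. flat M G \<and> F \<subseteq> G}. monom (moebius M F G) (rank M - rank_of M G))"
proof -
  have FE: "F \<subseteq> ground M" using assms by (rule flat_subset_ground)
  have rk: "rank_of (contraction M F) (G - F) = rank_of M G - rank_of M F"
    if "F \<subseteq> G" "G \<subseteq> ground M" for G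
    using rank_of_contraction[of "G - F" M F] that by (simp add: Un_absorb2 Diff_mono)
  have "rank (contraction M F) = rank M - rank_of M F"
    using rk[OF FE] by (simp add: rank_def)
  moreover have "charpoly (contraction M F) = (\<Sum>G\<in>{G. flat M G \<and> F \<subseteq> G}.
      monom (moebius (contraction M F) {} (G - F))
        (rank (contraction M F) - rank_of (contraction M F) (G - F)))"
    unfolding charpoly_def
    by (rule sum.reindex_bij_betw[OF bij_betw_flats_contraction[OF FE], symmetric])
  ultimately show ?thesis
    using FE rk rank_of_mono[of F _ M]
    by (auto intro!: sum.cong simp: moebius_contraction dest: flat_subset_ground)
qed

lemma reduced_charpoly_contraction_1:
  assumes "flat M F" "F \<noteq> ground M"
  shows "poly (reduced_charpoly (contraction M F)) 1 =
    (\<Sum>G\<in>{G. flat M G \<and> F \<subseteq> G}. moebius M F G * (int (rank M) - int (rank_of M G)))"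
proof -
  \<comment> \<open>At 1 all monomials become 1, and the Moebius values sum to 0 over the nontrivial
    interval from \<open>F\<close> to the ground set.\<close>
  have "poly (charpoly (contraction M F)) 1 =
      (\<Sum>G\<in>{G. flat M G \<and> F \<subseteq> G \<and> G \<subseteq> ground M}. moebius M F G)"
    using assms by (auto simp: charpoly_contraction poly_sum poly_monom
        dest: flat_subset_ground intro!: sum.cong)
  also have "\<dots> = 0"
    using sum_moebius[of M F "ground M"] assms by (simp add: flat_subset_ground)
  finally have "poly (reduced_charpoly (contraction M F)) 1 =
      poly (pderiv (charpoly (contraction M F))) 1"
    unfolding reduced_charpoly_def using poly_div_linear_eq_pderiv[of _ "1 :: int"] by simp
  thus ?thesis using assms
    by (auto simp: charpoly_contraction higher_pderiv_sum[of 1, simplified] poly_sum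
        pderiv_monom poly_monom rank_def of_nat_diff rank_of_mono dest!: flat_subset_ground intro!: sum.cong)
qed

lemma sum_reduced_charpoly_contraction_1:
  assumes "X \<subseteq> ground M"
  shows "(\<Sum>F\<in>{F. flat M F \<and> F \<noteq> ground M \<and> X \<subseteq> F}.
            poly (reduced_charpoly (contraction M F)) 1) = int (rank M) - int (rank_of M X)"
proof -
  define b where "b = (\<lambda>F. \<Sum>G\<in>{G. flat M G \<and> F \<subseteq> G}.
    moebius M F G * (int (rank M) - int (rank_of M G)))"
  obtain K where K: "flat M K" "rank_of M K = rank_of M X"
    "\<And>F. flat M F \<Longrightarrow> K \<subseteq> F \<longleftrightarrow> X \<subseteq> F"
    using closure_exists[OF assms] by blast
  \<comment> \<open>The formula \<open>b\<close> vanishes at the ground set, so that flat, absent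
    from the recursion, can be added to the sum before inverting.\<close>
  have "{G. flat M G \<and> ground M \<subseteq> G} = {ground M}" by (auto dest: flat_subset_ground)
  hence 0: "b (ground M) = 0" by (simp add: b_def rank_def)
  have "(\<Sum>F\<in>{F. flat M F \<and> F \<noteq> ground M \<and> X \<subseteq> F}.
            poly (reduced_charpoly (contraction M F)) 1) =
        (\<Sum>F\<in>{F. flat M F \<and> F \<noteq> ground M \<and> X \<subseteq> F}. b F)"
    by (intro sum.cong refl) (simp add: b_def reduced_charpoly_contraction_1)
  also have "\<dots> = (\<Sum>F\<in>{F. flat M F \<and> K \<subseteq> F}. b F)"
    using 0 K(3) by (intro sum.mono_neutral_left finite_subset[OF _ finite_flats[of M]]) auto
  also have "\<dots> = int (rank M) - int (rank_of M K)"
    unfolding b_def by (rule moebius_inversion[OF K(1)])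
  finally show ?thesis by (simp add: K(2))
qed

text \<open>Exchange the two sums: each \<open>p\<close> collects the flats containing
  \<open>X p\<close>. Indexing by \<open>P\<close> rather than by subsets allows one set to occur
  repeatedly, as for the two orders of a pair.\<close>

lemma sum_flats_weighted:
  fixes w :: "'b \<Rightarrow> rat"
  assumes "finite P" "\<And>p. p \<in> P \<Longrightarrow> X p \<subseteq> ground M"
  shows "(\<Sum>F\<in>{F. flat M F \<and> F \<noteq> ground M}. (\<Sum>p\<in>{p \<in> P. X p \<subseteq> F}. w p) *
            of_int (poly (reduced_charpoly (contraction M F)) 1)) =
         (\<Sum>p\<in>P. w p * (of_nat (rank M) - of_nat (rank_of M (X p))))"
proof -
  define A where "A = {F. flat M F \<and> F \<noteq> ground M}"
  define b :: "'a set \<Rightarrow> rat"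
    where "b = (\<lambda>F. of_int (poly (reduced_charpoly (contraction M F)) 1))"
  have A: "finite A" unfolding A_def by (rule finite_subset[OF _ finite_flats[of M]]) auto
  have "(\<Sum>F\<in>A. (\<Sum>p\<in>{p \<in> P. X p \<subseteq> F}. w p) * b F) =
        (\<Sum>F\<in>A. \<Sum>p\<in>{p \<in> P. X p \<subseteq> F}. w p * b F)"
    by (simp add: sum_distrib_right)
  also have "\<dots> = (\<Sum>p\<in>P. \<Sum>F\<in>{F \<in> A. X p \<subseteq> F}. w p * b F)"
    by (rule sum.swap_restrict[OF A assms(1)])
  also have "\<dots> = (\<Sum>p\<in>P. w p * (of_nat (rank M) - of_nat (rank_of M (X p))))"
  proof (intro sum.cong refl)
    fix p assume p: "p \<in> P"
    have "(\<Sum>F\<in>{F \<in> A. X p \<subseteq> F}. b F) =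
        of_int (\<Sum>F\<in>{F. flat M F \<and> F \<noteq> ground M \<and> X p \<subseteq> F}.
            poly (reduced_charpoly (contraction M F)) 1)"
      by (simp add: A_def b_def conj_assoc)
    thus "(\<Sum>F\<in>{F \<in> A. X p \<subseteq> F}. w p * b F) =
        w p * (of_nat (rank M) - of_nat (rank_of M (X p)))"
      using sum_reduced_charpoly_contraction_1[OF assms(2)[OF p]]
      by (simp flip: sum_distrib_left)
  qed
  finally show ?thesis by (simp add: A_def b_def)
qed

section \<open>The power series expansion of the zeta function\<close>

text \<open>Taking the regular part loses nothing, because there is no pole at 0.\<close>

definition zeta_series :: "'a matroid \<Rightarrow> rat fps" where
  "zeta_series M = fls_regpart (expansion_at_0 (zeta_top M))"

lemma expansion_at_0_zeta_top: "expansion_at_0 (zeta_top M) = fps_to_fls (zeta_series M)"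
  using zeta_top_no_pole[of M] by (auto simp: zeta_series_def)

lemma zeta_series_rank_0: "rank M = 0 \<Longrightarrow> zeta_series M = 1"
  by (simp add: zeta_series_def zeta_top.simps)

lemma zeta_series_rec:
  assumes "rank M \<noteq> 0"
  shows "fps_of_poly [:of_nat (rank M), of_nat (card (ground M)):] * zeta_series M =
    (\<Sum>F\<in>{F. flat M F \<and> F \<noteq> ground M}. zeta_series (restriction M F) *
        of_int (poly (reduced_charpoly (contraction M F)) 1))"
    (is "fps_of_poly ?d * _ = ?S")
proof -
  have d: "?d \<noteq> 0" using assms by simp
  have "expansion_at_0 (zeta_top M) = fps_to_fls ?S / fps_to_fls (fps_of_poly ?d)"
    using assms d by (subst zeta_top.simps)
      (simp add: expansion_at_0_mult expansion_at_0_sum expansion_at_0_Fract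
        expansion_at_0_zeta_top fps_to_fls_sum fls_times_fps_to_fls)
  hence "fps_to_fls (fps_of_poly ?d) * fps_to_fls (zeta_series M) = fps_to_fls ?S"
    using d by (simp add: expansion_at_0_zeta_top)
  thus ?thesis by (simp only: fls_times_fps_to_fls[symmetric] fps_to_fls_eq_iff)
qed

lemma fps_nth_of_linear_mult:
  fixes a c :: "'b :: comm_ring_1"
  shows "fps_nth (fps_of_poly [:a, c:] * f) 0 = a * fps_nth f 0"
    and "fps_nth (fps_of_poly [:a, c:] * f) (Suc k) = a * fps_nth f (Suc k) + c * fps_nth f k"
  by (simp_all add: fps_of_poly_pCons algebra_simps)

text \<open>The induction step for one coefficient; it is applied with \<open>X p\<close> empty, a
  singleton and a pair for \<open>k\<close> equal to 0, 1 and 2.\<close>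

lemma zeta_series_nth_rec:
  fixes w :: "'b \<Rightarrow> rat"
  assumes "rank M \<noteq> 0" "finite P" "\<And>p. p \<in> P \<Longrightarrow> X p \<subseteq> ground M"
    and coeff: "\<And>F. flat M F \<Longrightarrow> F \<noteq> ground M \<Longrightarrow>
      fps_nth (zeta_series (restriction M F)) k = (\<Sum>p\<in>{p \<in> P. X p \<subseteq> F}. w p)"
  shows "fps_nth (fps_of_poly [:of_nat (rank M), of_nat (card (ground M)):] * zeta_series M) k =
    (\<Sum>p\<in>P. w p * (of_nat (rank M) - of_nat (rank_of M (X p))))"
proof -
  have of_int: "fps_nth (f * of_int c) k = fps_nth f k * of_int c" for f :: "rat fps" and c
    by (simp flip: fps_of_int)
  have "fps_nth (fps_of_poly [:of_nat (rank M), of_nat (card (ground M)):] * zeta_series M) k =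
      (\<Sum>F\<in>{F. flat M F \<and> F \<noteq> ground M}. (\<Sum>p\<in>{p \<in> P. X p \<subseteq> F}. w p) *
            of_int (poly (reduced_charpoly (contraction M F)) 1))"
    unfolding zeta_series_rec[OF assms(1)] fps_sum_nth of_int
    by (intro sum.cong refl) (simp add: coeff)
  thus ?thesis using sum_flats_weighted[OF assms(2,3)] by simp
qed

text \<open>The weight \<open>1 / rank_of M {x, y}\<close> is chosen so that the rank terms in the recursion
  add up to the number of ordered pairs, which cancels the contribution of the linear coefficient.\<close>

lemma zeta_series_coeffs:
  assumes "loopless M"
  shows "fps_nth (zeta_series M) 0 = 1 \<and>
    fps_nth (zeta_series M) 1 = - of_nat (card (ground M)) \<and>
    fps_nth (zeta_series M) 2 = (\<Sum>(x, y)\<in>ground M \<times> ground M. 1 / of_nat (rank_of M {x, y}))"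
  using assms
proof (induction "card (ground M)" arbitrary: M rule: less_induct)
  case less
  let ?E = "ground M" and ?Z = "zeta_series M"
  let ?r = "of_nat (rank M) :: rat" and ?n = "of_nat (card (ground M)) :: rat"
  let ?d = "fps_of_poly [:?r, ?n:]"
  have rk1: "rank_of M {x} = 1" if "x \<in> ?E" for x
    using rank_of_singleton[OF less.prems that] .
  show ?case
  proof (cases "rank M = 0")
    case True
    \<comment> \<open>Loopless of rank 0 means no elements, so the claimed coefficients are 1, 0, 0,
      those of the series 1.\<close>
    have "?E = {}"
    proof (rule ccontr)
      assume "?E \<noteq> {}"
      then obtain x where x: "x \<in> ?E" by blast
      hence "rank_of M {x} \<le> rank M" unfolding rank_def by (intro rank_of_mono) auto
      thus False using rk1[OF x] True by simp
    qed
    thus ?thesis using True by (simp add: zeta_series_rank_0)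
  next
    case False
    have IH: "fps_nth (zeta_series (restriction M F)) 0 = 1"
      "fps_nth (zeta_series (restriction M F)) 1 = - of_nat (card F)"
      "fps_nth (zeta_series (restriction M F)) 2 =
        (\<Sum>(x, y)\<in>F \<times> F. 1 / of_nat (rank_of M {x, y}))"
      if "flat M F" "F \<noteq> ?E" for F
    proof -
      have "F \<subset> ?E" using that by (auto dest: flat_subset_ground)
      hence g: "ground (restriction M F) = F" by auto
      have "card (ground (restriction M F)) < card ?E"
        unfolding g using \<open>F \<subset> ?E\<close> by (intro psubset_card_mono) auto
      note * = less.hyps[OF this loopless_restriction[OF less.prems], unfolded g]
      show "fps_nth (zeta_series (restriction M F)) 0 = 1"
        "fps_nth (zeta_series (restriction M F)) 1 = - of_nat (card F)"
        using * by simp_all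
      show "fps_nth (zeta_series (restriction M F)) 2 =
          (\<Sum>(x, y)\<in>F \<times> F. 1 / of_nat (rank_of M {x, y}))"
        using * by (auto simp: rank_of_restriction intro!: sum.cong)
    qed
    \<comment> \<open>A single index whose set is empty, hence inside every flat, encodes the
      constant 1.\<close>
    have "fps_nth (?d * ?Z) 0 = (\<Sum>p\<in>{()}. 1 * (?r - of_nat (rank_of M {})))"
      by (rule zeta_series_nth_rec[OF False]) (auto simp: IH)
    hence z0: "fps_nth ?Z 0 = 1" using False by (simp add: fps_nth_of_linear_mult)
    have "fps_nth (?d * ?Z) 1 = (\<Sum>x\<in>?E. (- 1) * (?r - of_nat (rank_of M {x})))"
    proof (rule zeta_series_nth_rec[OF False])
      fix F assume F: "flat M F" "F \<noteq> ?E"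
      have "{x \<in> ?E. {x} \<subseteq> F} = F" using flat_subset_ground[OF F(1)] by auto
      thus "fps_nth (zeta_series (restriction M F)) 1 = (\<Sum>x\<in>{x \<in> ?E. {x} \<subseteq> F}. - 1)"
        using IH(2)[OF F] by simp
    qed auto
    also have "\<dots> = - (?n * (?r - 1))" by (simp add: rk1 algebra_simps)
    \<comment> \<open>The left-hand coefficient is \<open>?r * fps_nth ?Z 1 + ?n\<close>, by
      \<open>z0\<close>.\<close>
    finally have "?r * fps_nth ?Z 1 = ?r * - ?n"
      using fps_nth_of_linear_mult(2)[of ?r ?n ?Z 0] z0 by (simp add: algebra_simps)
    hence z1: "fps_nth ?Z 1 = - ?n" using False by (subst (asm) mult_cancel_left) simp
    define w :: "'a \<times> 'a \<Rightarrow> rat" where "w = (\<lambda>(x, y). 1 / of_nat (rank_of M {x, y}))"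
    have "fps_nth (?d * ?Z) 2 =
        (\<Sum>p\<in>?E \<times> ?E. w p * (?r - of_nat (rank_of M {fst p, snd p})))"
    proof (rule zeta_series_nth_rec[OF False])
      fix F assume F: "flat M F" "F \<noteq> ?E"
      have "{p \<in> ?E \<times> ?E. {fst p, snd p} \<subseteq> F} = F \<times> F"
        using flat_subset_ground[OF F(1)] by auto
      thus "fps_nth (zeta_series (restriction M F)) 2 =
          (\<Sum>p\<in>{p \<in> ?E \<times> ?E. {fst p, snd p} \<subseteq> F}. w p)"
        using IH(3)[OF F] by (simp add: w_def)
    qed auto
    \<comment> \<open>The weight times the rank is 1, as looplessness makes every such rank
      positive.\<close>
    also have "\<dots> = (\<Sum>p\<in>?E \<times> ?E. ?r * w p - 1)"
      using less.prems by (intro sum.cong refl) (auto simp: w_def rank_of_pair rank_of_singleton algebra_simps)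
    also have "\<dots> = ?r * (\<Sum>p\<in>?E \<times> ?E. w p) - ?n * ?n"
      by (simp add: sum_subtractf sum_distrib_left card_cartesian_product)
    finally have "?r * fps_nth ?Z 2 = ?r * (\<Sum>p\<in>?E \<times> ?E. w p)"
      using fps_nth_of_linear_mult(2)[of ?r ?n ?Z 1] z1 by (simp add: numeral_2_eq_2 algebra_simps)
    hence "fps_nth ?Z 2 = (\<Sum>p\<in>?E \<times> ?E. w p)"
      using False by (subst (asm) mult_cancel_left) simp
    thus ?thesis using z0 z1 by (simp add: w_def)
  qed
qed

section \<open>Counting parallel pairs\<close>

lemma circuit_pair_iff:
  assumes "loopless M" "x \<noteq> y"
  shows "circuit M {x, y} \<longleftrightarrow> x \<in> ground M \<and> y \<in> ground M \<and> \<not> indep M {x, y}"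
proof -
  have "indep M D" if D: "D \<subset> {x, y}" and "x \<in> ground M" "y \<in> ground M" for D
  proof -
    have "D \<subseteq> {x} \<or> D \<subseteq> {y}" using D by auto
    moreover have "indep M {x}" "indep M {y}" using that assms(1) by (simp_all add: loopless_def)
    ultimately show ?thesis using indep_mono by blast
  qed
  thus ?thesis by (auto simp: circuit_def)
qed

text \<open>Each circuit of size 2 comes from exactly its two orderings.\<close>

lemma card_parallel_pairs:
  assumes "loopless M"
  shows "card {(x, y). x \<in> ground M \<and> y \<in> ground M \<and> x \<noteq> y \<and> \<not> indep M {x, y}} =
    2 * card {C. circuit M C \<and> card C = 2}"
    (is "card ?P = 2 * card ?C")
proof -
  have fin: "finite ?C"
    by (rule finite_subset[of _ "Pow (ground M)"]) (auto simp: circuit_def)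
  have "?P = (\<Union>C\<in>?C. {(x, y). x \<noteq> y \<and> {x, y} = C})"
    using assms by (auto simp: circuit_pair_iff)
  moreover have card: "card {(x, y). x \<noteq> y \<and> {x, y} = C} = 2" if C: "C \<in> ?C" for C
  proof -
    obtain a b where "C = {a, b}" "a \<noteq> b" using C by (auto simp: card_2_iff)
    hence "{(x, y). x \<noteq> y \<and> {x, y} = C} = {(a, b), (b, a)}"
      by (auto simp: doubleton_eq_iff)
    thus ?thesis using \<open>a \<noteq> b\<close> by simp
  qed
  moreover have "card (\<Union>C\<in>?C. {(x, y). x \<noteq> y \<and> {x, y} = C}) =
      (\<Sum>C\<in>?C. card {(x, y). x \<noteq> y \<and> {x, y} = C})"
    using fin card by (intro card_UN_disjoint) (auto intro!: card_ge_0_finite)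
  ultimately show ?thesis by simp
qed

lemma sum_inverse_rank_of_pairs:
  assumes "loopless M" "card (ground M) = n"
  shows "(\<Sum>(x, y)\<in>ground M \<times> ground M. 1 / of_nat (rank_of M {x, y})) =
    (of_nat ((n + 1) choose 2) + of_nat (card {C. circuit M C \<and> card C = 2}) :: rat)"
proof -
  let ?E = "ground M"
  let ?P = "{(x, y). x \<in> ground M \<and> y \<in> ground M \<and> x \<noteq> y \<and> \<not> indep M {x, y}}"
  have fin: "finite ?P" by (rule finite_subset[of _ "?E \<times> ?E"]) auto
  have "(\<Sum>(x, y)\<in>?E \<times> ?E. 1 / of_nat (rank_of M {x, y})) =
      (\<Sum>p\<in>?E \<times> ?E. 1 / 2 + (if fst p = snd p then 1 / 2 else 0) + (if p \<in> ?P then 1 / 2 else 0) :: rat)"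
    using assms(1) by (intro sum.cong refl) (auto simp: rank_of_pair rank_of_singleton)
  also have "\<dots> = of_nat (card (?E \<times> ?E)) / 2 + (\<Sum>p\<in>(\<lambda>x. (x, x)) ` ?E. 1 / 2) + (\<Sum>p\<in>?P. 1 / 2)"
    unfolding sum.distrib
    by (intro arg_cong2[where f = "(+)"] sum.mono_neutral_cong_right) (auto simp: fin)
  also have "\<dots> = of_nat (n * n) / 2 + of_nat n / 2 + of_nat (card ?P) / 2"
    using assms(2) by (simp add: card_cartesian_product card_image inj_on_def)
  also have "of_nat (n * n) / 2 + of_nat n / 2 = (of_nat ((n + 1) choose 2) :: rat)"
  proof -
    have "2 * ((n + 1) choose 2) = n * n + n" by (simp add: choose_two)
    hence "2 * (of_nat ((n + 1) choose 2) :: rat) = of_nat (n * n) + of_nat n"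
      by (metis of_nat_add of_nat_mult of_nat_numeral)
    thus ?thesis by simp
  qed
  finally show ?thesis using card_parallel_pairs[OF assms(1)] by simp
qed

theorem theorem1p2:
  fixes M :: "'a matroid" and n :: nat
  assumes "loopless M" and "card (ground M) = n"
  shows "fls_nth (expansion_at_0 (zeta_top M)) 2 =
           of_nat ((n + 1) choose 2) + of_nat (card {C. circuit M C \<and> card C = 2}) \<and>
         (simple_matroid M \<longrightarrow>
           fls_nth (expansion_at_0 (zeta_top M)) 2 = of_nat ((n + 1) choose 2))"
proof -
  have "fls_nth (expansion_at_0 (zeta_top M)) 2 =
      of_nat ((n + 1) choose 2) + of_nat (card {C. circuit M C \<and> card C = 2})"
    using zeta_series_coeffs[OF assms(1)] sum_inverse_rank_of_pairs[OF assms]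
    by (simp add: expansion_at_0_zeta_top)
  moreover have "{C. circuit M C \<and> card C = 2} = {}" if "simple_matroid M"
    using that by (auto simp: simple_matroid_def circuit_def card_2_iff)
  ultimately show ?thesis by (metis add_0_right card.empty of_nat_0)
qed

end
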